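(* Let $\phi_1,\dots,\phi_r$ be Koopman eigenfunctions of the system $\boldsymbol{\upsilon}^+=\Gamma(\boldsymbol{\upsilon})$ on $\mathbb{R}^p$ with pairwise distinct eigenvalues $\lambda_1,\dots,\lambda_r\in\mathbb{C}$. Let $\boldsymbol{\psi}=[\psi_i]_{i=1}^m$ be a finite collection (dictionary) of functions, each lying in the linear span of $\phi_1,\dots,\phi_r$. Observe the system through $\boldsymbol{\psi}$ at $n+1$ sequential time instances, starting at an initial state $\boldsymbol{\upsilon}_1$ with $\phi_i(\boldsymbol{\upsilon}_1)\neq 0$ for all $i=1,\dots,r$, giving the data matrices $\mathbf{Z},\mathbf{X},\mathbf{Y}$, and let $\{\tilde\lambda_i\}_{i=1}^n$ be the resulting mean-subtracted DMD eigenvalues. If $(\mathbf{X},\mathbf{Y})$ is linearly consistent and $n\ge r+1$, then $$\{\tilde\lambda_i\}_{i=1}^n\neq\{z\in\mathbb{C}: z\neq 1,\ z^{n+1}=1\},$$ i.e. mean-subtracted DMD is not a temporal DFT.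
   Context: Setting: $\Gamma:\mathbb{R}^p\to\mathbb{R}^p$ is a map. $\mathcal{H}$ is a vector space of complex-valued functions on $\mathbb{R}^p$ closed under composition with $\Gamma$, and the Koopman operator is $U:\mathcal{H}\to\mathcal{H}$, $U\psi=\psi\circ\Gamma$. A Koopman eigenfunction with eigenvalue $\lambda$ is a function $\phi\in\mathcal{H}$ with $U\phi=\lambda\phi$. Data: $\mathbf{z}_j=\boldsymbol{\psi}(\Gamma^{j-1}(\boldsymbol{\upsilon}_1))\in\mathbb{C}^m$ for $j=1,\dots,n+1$; $\mathbf{Z}=[\mathbf{z}_1,\dots,\mathbf{z}_{n+1}]$, $\mathbf{X}=[\mathbf{z}_1,\dots,\mathbf{z}_n]$, $\mathbf{Y}=[\mathbf{z}_2,\dots,\mathbf{z}_{n+1}]$. The pair $(\mathbf{X},\mathbf{Y})$ is linearly consistent if there is a matrix $\mathbf{A}$ with $\mathbf{A}\mathbf{X}=\mathbf{Y}$. Mean-subtracted DMD: let $\boldsymbol{\mu}=\frac{1}{n+1}\sum_{j=1}^{n+1}\mathbf{z}_j$, $\mathbf{X}_{\rm ms}=[\mathbf{z}_j-\boldsymbol{\mu}]_{j=1}^n$, and $\mathbf{c}^*=\mathbf{X}_{\rm ms}^{\dagger}(\mathbf{z}_{n+1}-\boldsymbol{\mu})\in\mathbb{C}^n$, where $\dagger$ is the Moore-Penrose pseudo-inverse. The mean-subtracted DMD eigenvalues $\{\tilde\lambda_i\}_{i=1}^n$ are the eigenvalues of the $n\times n$ companion matrix $\mathbf{T}[\mathbf{c}^*]$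 having $1$'s on the first sub-diagonal, last column $\mathbf{c}^*$, and zeros elsewhere. *)

theory Defs
  imports
    "HOL-Analysis.Finite_Cartesian_Product"
    "HOL-Library.Function_Algebras"
    "Jordan_Normal_Form.Schur_Decomposition"
    "Jordan_Normal_Form.Spectral_Radius"
begin

unbundle no vec_syntax

hide_type (open) Finite_Cartesian_Product.vec

section \<open>Koopman operator\<close>

global_interpretation cfun: vector_space "\<lambda>(c::complex) (f :: 'a \<Rightarrow> complex) x. c * f x"
  defines cfun_subspace = cfun.subspace and cfun_span = cfun.span
  by unfold_locales (auto simp: algebra_simps)

definition koopman :: "('a \<Rightarrow> 'a) \<Rightarrow> ('a \<Rightarrow> complex) \<Rightarrow> 'a \<Rightarrow> complex" where
  "koopman \<Gamma> \<psi> = \<psi> \<circ> \<Gamma>"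

text \<open>As usual in this setting, the zero function is not excluded here; it has to be excluded
  where it matters, for instance by requiring the eigenfunction not to vanish at the initial state.\<close>

definition koopman_eigenfunction ::
    "('a \<Rightarrow> complex) set \<Rightarrow> ('a \<Rightarrow> 'a) \<Rightarrow> ('a \<Rightarrow> complex) \<Rightarrow> complex \<Rightarrow> bool" where
  "koopman_eigenfunction H \<Gamma> \<phi> l \<longleftrightarrow> \<phi> \<in> H \<and> koopman \<Gamma> \<phi> = (\<lambda>x. l * \<phi> x)"

section \<open>Snapshot data\<close>

text \<open>Dictionary members and snapshots are numbered from 1, while the entries of
  a vector and the rows and columns of a matrix are numbered from 0.\<close>

definition snapshot ::
    "('a \<Rightarrow> 'a) \<Rightarrow> nat \<Rightarrow> (nat \<Rightarrow> 'a \<Rightarrow> complex) \<Rightarrow> 'a \<Rightarrow> nat \<Rightarrow> complex vec" where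
  "snapshot \<Gamma> m \<psi> \<upsilon>\<^sub>1 j = vec m (\<lambda>i. \<psi> (i + 1) ((\<Gamma> ^^ (j - 1)) \<upsilon>\<^sub>1))"

definition data_X :: "nat \<Rightarrow> nat \<Rightarrow> (nat \<Rightarrow> complex vec) \<Rightarrow> complex mat" where
  "data_X m n z = mat_of_cols m (map z [1..<n + 1])"

definition data_Y :: "nat \<Rightarrow> nat \<Rightarrow> (nat \<Rightarrow> complex vec) \<Rightarrow> complex mat" where
  "data_Y m n z = mat_of_cols m (map z [2..<n + 2])"

definition linearly_consistent :: "complex mat \<Rightarrow> complex mat \<Rightarrow> bool" where
  "linearly_consistent X Y \<longleftrightarrow> (\<exists>A \<in> carrier_mat (dim_row Y) (dim_row X). A * X = Y)"

section \<open>Mean-subtracted DMD\<close>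

text \<open>The Moore-Penrose pseudo-inverse: the unique solution of the four Penrose equations.\<close>

definition is_pinv :: "complex mat \<Rightarrow> complex mat \<Rightarrow> bool" where
  "is_pinv A B \<longleftrightarrow> B \<in> carrier_mat (dim_col A) (dim_row A) \<and>
     A * B * A = A \<and> B * A * B = B \<and>
     mat_adjoint (A * B) = A * B \<and> mat_adjoint (B * A) = B * A"

definition pinv :: "complex mat \<Rightarrow> complex mat" where
  "pinv A = (THE B. is_pinv A B)"

definition temporal_mean :: "nat \<Rightarrow> nat \<Rightarrow> (nat \<Rightarrow> complex vec) \<Rightarrow> complex vec" where
  "temporal_mean m n z = vec m (\<lambda>i. (\<Sum>j = 1..n + 1. z j $ i) / of_nat (n + 1))"

definition data_X_ms :: "nat \<Rightarrow> nat \<Rightarrow> (nat \<Rightarrow> complex vec) \<Rightarrow> complex mat" where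
  "data_X_ms m n z = mat_of_cols m (map (\<lambda>j. z j - temporal_mean m n z) [1..<n + 1])"

definition ms_coeffs :: "nat \<Rightarrow> nat \<Rightarrow> (nat \<Rightarrow> complex vec) \<Rightarrow> complex vec" where
  "ms_coeffs m n z = pinv (data_X_ms m n z) *\<^sub>v (z (n + 1) - temporal_mean m n z)"

definition companion :: "complex vec \<Rightarrow> complex mat" where
  "companion c = (let n = dim_vec c in
     mat n n (\<lambda>(i, j). if j = n - 1 then c $ i else if i = j + 1 then 1 else 0))"

text \<open>The eigenvalues are collected as a set, without multiplicities. Comparing them with
  a set of \<open>n\<close> distinct numbers loses nothing: an \<open>n \<times> n\<close> matrix with that spectrum
  has only simple eigenvalues.\<close>

definition ms_DMD_eigenvalues :: "nat \<Rightarrow> nat \<Rightarrow> (nat \<Rightarrow> complex vec) \<Rightarrow> complex set" where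
  "ms_DMD_eigenvalues m n z = spectrum (companion (ms_coeffs m n z))"

end

theory Submission
  imports Defs
begin

text \<open>A companion matrix whose spectrum is the set of the nontrivial roots of unity of order
  \<open>n + 1\<close> has the last column \<open>(-1, \<dots>, -1)\<close>. On the other hand the DMD coefficients lie in the
  range of a pseudo-inverse and are therefore orthogonal to the kernel of the mean-subtracted data.
  So it suffices to find a vector \<open>a\<close> in that kernel with entry sum 1. Reading \<open>a\<close> as the
  coefficients of a polynomial \<open>p\<close> of degree less than \<open>n\<close>, this amounts to \<open>p(1) = 1\<close> and
  \<open>p(\<lambda>) = (1 + \<lambda> + \<dots> + \<lambda>\<^sup>n) / (n + 1)\<close> for every eigenvalue \<open>\<lambda>\<close>: at most \<open>r + 1 \<le> n\<close>
  interpolation conditions, which agree with each other if \<open>\<lambda> = 1\<close>.\<close>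

section \<open>The Moore-Penrose inverse\<close>

text \<open>With dimension equations as premises instead of carrier memberships, \<open>simp\<close>
  can discharge the side conditions while it reassociates products.\<close>

lemma assoc_mult_mat_dim:
  fixes A B C :: "'a :: semiring_0 mat"
  assumes "dim_col A = dim_row B" "dim_col B = dim_row C"
  shows "A * B * C = A * (B * C)"
  by (rule assoc_mult_mat; rule carrier_matI) (rule refl assms assms[symmetric])+

section \<open>Adjoints of complex matrices\<close>

lemma mat_adjoint_dim [simp]:
  "dim_row (mat_adjoint A) = dim_col A" "dim_col (mat_adjoint A) = dim_row A"
  by (auto simp: mat_adjoint_def)

lemma mat_adjoint_index [simp]:
  "i < dim_col A \<Longrightarrow> j < dim_row A \<Longrightarrow> mat_adjoint A $$ (i, j) = conjugate (A $$ (j, i))"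
  by (auto simp: mat_adjoint_def mat_of_rows_index)

lemma mat_adjoint_adjoint [simp]: "mat_adjoint (mat_adjoint A) = A"
  by (rule eq_matI) auto

lemma mat_adjoint_mult:
  fixes A B :: "complex mat"
  assumes "dim_col A = dim_row B"
  shows "mat_adjoint (A * B) = mat_adjoint B * mat_adjoint A"
proof (rule eq_matI)
  fix i j assume "i < dim_row (mat_adjoint B * mat_adjoint A)"
    and "j < dim_col (mat_adjoint B * mat_adjoint A)"
  then have ij: "i < dim_col B" "j < dim_row A" by auto
  have "mat_adjoint (A * B) $$ (i, j) = cnj (\<Sum>k<dim_row B. A $$ (j, k) * B $$ (k, i))"
    using ij assms by (simp add: scalar_prod_def lessThan_atLeast0)
  also have "\<dots> = (\<Sum>k<dim_row B. cnj (B $$ (k, i)) * cnj (A $$ (j, k)))"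
    by (simp add: mult.commute)
  also have "\<dots> = (mat_adjoint B * mat_adjoint A) $$ (i, j)"
    using ij assms by (simp add: scalar_prod_def lessThan_atLeast0)
  finally show "mat_adjoint (A * B) $$ (i, j) = (mat_adjoint B * mat_adjoint A) $$ (i, j)" .
qed auto

text \<open>The diagonal entries of the product are the squared norms of the columns of
  \<open>M\<close>.\<close>

lemma mat_adjoint_mult_self_eq_0:
  fixes M :: "complex mat"
  assumes "mat_adjoint M * M = 0\<^sub>m (dim_col M) (dim_col M)"
  shows "M = 0\<^sub>m (dim_row M) (dim_col M)"
proof (rule eq_matI)
  fix i j assume "i < dim_row (0\<^sub>m (dim_row M) (dim_col M) :: complex mat)"
    and "j < dim_col (0\<^sub>m (dim_row M) (dim_col M) :: complex mat)"
  then have ij: "i < dim_row M" "j < dim_col M" by auto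
  have "(mat_adjoint M * M) $$ (j, j) = (\<Sum>k<dim_row M. cnj (M $$ (k, j)) * M $$ (k, j))"
    using ij by (auto simp: scalar_prod_def lessThan_atLeast0)
  also have "\<dots> = complex_of_real (\<Sum>k<dim_row M. (cmod (M $$ (k, j)))\<^sup>2)"
    by (simp add: mult.commute flip: complex_norm_square)
  finally have "(\<Sum>k<dim_row M. (cmod (M $$ (k, j)))\<^sup>2) = 0"
    using ij assms by (metis index_zero_mat(1) of_real_eq_0_iff)
  then show "M $$ (i, j) = 0\<^sub>m (dim_row M) (dim_col M) $$ (i, j)"
    using ij by (simp add: sum_nonneg_eq_0_iff)
qed auto

section \<open>Existence and uniqueness of the pseudo-inverse\<close>

lemma sum_fun_apply: "sum f S x = (\<Sum>i\<in>S. f i x)"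
  for f :: "'b \<Rightarrow> 'a \<Rightarrow> complex"
  by (induction S rule: infinite_finite_induct) auto

text \<open>\<open>A\<close> acts as a linear map \<open>f\<close> on sequences, a vector space
  whose type does not depend on the dimensions. A linear right inverse \<open>g\<close> of
  \<open>f\<close> on its range satisfies f g f = f, and \<open>G\<close> is the matrix of
  \<open>g\<close>.\<close>

lemma generalized_inverse_exists:
  fixes A :: "complex mat"
  obtains G where "G \<in> carrier_mat (dim_col A) (dim_row A)" "A * G * A = A"
proof -
  define s where "s = (\<lambda>(c::complex) (f :: nat \<Rightarrow> complex) x. c * f x)"
  interpret vector_space_pair s s
    unfolding s_def by unfold_locales
  define f where "f = (\<lambda>v i. if i < dim_row A then \<Sum>j<dim_col A. A $$ (i, j) * v j else 0)"
  define e :: "nat \<Rightarrow> nat \<Rightarrow> complex" where "e = (\<lambda>j k. if k = j then 1 else 0)"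
  have "Vector_Spaces.linear s s f"
    unfolding Vector_Spaces.linear_iff using vector_space_pair_axioms
    by (auto simp: vector_space_pair_def f_def s_def fun_eq_iff sum.distrib sum_distrib_left
        algebra_simps)
  from linear_exists_right_inverse_on[OF this vs1.subspace_UNIV]
  obtain g where g: "Vector_Spaces.linear s s g" "\<forall>v\<in>range f. f (g v) = v"
    by auto
  then have f_g_f: "f (g (f v)) = f v" for v
    by simp
  \<comment> \<open>The coordinates of \<open>g (e j)\<close> from \<open>dim_col A\<close> on are
    cut off. This is harmless, since \<open>f\<close> never reads them.\<close>
  define G where "G = mat (dim_col A) (dim_row A) (\<lambda>(i, j). g (e j) i)"
  have f_e: "f (e k) i = A $$ (i, k)" if "i < dim_row A" "k < dim_col A" for i k
    using that by (simp add: f_def e_def if_distrib[of "(*) _"] cong: if_cong)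
  \<comment> \<open>The \<open>e j\<close> do not span all sequences, but \<open>f (e k)\<close> has
    finite support and is a finite combination of them, so linearity of \<open>g\<close> applies to
    it.\<close>
  have f_e_sum: "f (e k) = (\<Sum>j<dim_row A. s (A $$ (j, k)) (e j))" if "k < dim_col A" for k
  proof
    fix i
    have "(\<Sum>j<dim_row A. s (A $$ (j, k)) (e j)) i =
      (\<Sum>j<dim_row A. if i = j then A $$ (j, k) else 0)"
      unfolding sum_fun_apply by (intro sum.cong) (simp_all add: s_def e_def)
    also have "\<dots> = (if i < dim_row A then A $$ (i, k) else 0)"
      by simp
    also have "\<dots> = f (e k) i"
    proof (cases "i < dim_row A")
      case True
      then show ?thesis using that f_e by simp
    next
      case False
      then show ?thesis by (simp add: f_def)
    qed
    finally show "f (e k) i = (\<Sum>j<dim_row A. s (A $$ (j, k)) (e j)) i" ..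
  qed
  have "g (f (e k)) = (\<Sum>j<dim_row A. s (A $$ (j, k)) (g (e j)))" if "k < dim_col A" for k
    unfolding f_e_sum[OF that] by (simp add: linear_sum[OF g(1)] linear_scale[OF g(1)])
  then have g_f_e: "g (f (e k)) l = (\<Sum>j<dim_row A. A $$ (j, k) * g (e j) l)"
    if "k < dim_col A" for k l
    using that by (simp add: sum_fun_apply s_def)
  have G_A: "(G * A) $$ (l, k) = g (f (e k)) l" if "l < dim_col A" "k < dim_col A" for l k
    using that by (simp add: G_def g_f_e scalar_prod_def lessThan_atLeast0 mult.commute)
  have "A * (G * A) = A"
  proof (rule eq_matI)
    fix i k assume ik: "i < dim_row A" "k < dim_col A"
    have "(A * (G * A)) $$ (i, k) = (\<Sum>l<dim_col A. A $$ (i, l) * (G * A) $$ (l, k))"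
      using ik by (simp add: scalar_prod_def G_def lessThan_atLeast0)
    also have "\<dots> = f (g (f (e k))) i"
      using ik by (simp add: G_A f_def)
    finally show "(A * (G * A)) $$ (i, k) = A $$ (i, k)"
      using ik by (simp add: f_g_f f_e)
  qed (auto simp: G_def)
  then show ?thesis
    using assoc_mult_mat_dim[of A G A] by (intro that[of G]) (simp_all add: G_def)
qed

text \<open>If \<open>G\<close> is a generalized inverse of \<open>A' * A\<close>, then
  \<open>P = A * G * A'\<close> is the orthogonal projection onto the column space of
  \<open>A\<close>, and \<open>G * A'\<close> is the required matrix.\<close>

lemma least_squares_inverse_exists:
  fixes A :: "complex mat"
  obtains X where "X \<in> carrier_mat (dim_col A) (dim_row A)" "A * X * A = A"
    "mat_adjoint (A * X) = A * X"
proof -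
  define A' where "A' = mat_adjoint A"
  have dim_A' [simp]: "dim_row A' = dim_col A" "dim_col A' = dim_row A"
    by (auto simp: A'_def)
  obtain G where "G \<in> carrier_mat (dim_col A) (dim_col A)" and "(A' * A) * G * (A' * A) = A' * A"
    using generalized_inverse_exists[of "A' * A"] by auto
  then have G [simp]: "dim_row G = dim_col A" "dim_col G = dim_col A"
    and G_eq: "A' * (A * (G * (A' * A))) = A' * A"
    by (auto simp: assoc_mult_mat_dim)
  define P where "P = A * G * A'"
  define M where "M = P * A - A"
  have dim_P [simp]: "dim_row P = dim_row A" "dim_col P = dim_row A"
    by (auto simp: P_def)
  have carrier: "A \<in> carrier_mat (dim_row A) (dim_col A)"
    "A' \<in> carrier_mat (dim_col A) (dim_row A)" "P * A \<in> carrier_mat (dim_row A) (dim_col A)"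
    "G * (A' * A) \<in> carrier_mat (dim_col A) (dim_col A)"
    by (intro carrier_matI; simp)+
  have "A' * (P * A) = A' * A"
    using G_eq by (simp add: P_def assoc_mult_mat_dim)
  then have A'_M: "A' * M = 0\<^sub>m (dim_col A) (dim_col A)"
    unfolding M_def mult_minus_distrib_mat[OF carrier(2,3,1)] by auto
  have "P * A = A * (G * (A' * A))"
    by (simp add: P_def assoc_mult_mat_dim)
  \<comment> \<open>As \<open>M\<close> has the left factor \<open>A\<close>, its adjoint has the
    right factor \<open>A'\<close>. So \<open>mat_adjoint M * M\<close> contains
    \<open>A' * M\<close>, which is zero.\<close>
  then have M_eq: "M = A * (G * (A' * A) - 1\<^sub>m (dim_col A))"
    unfolding M_def mult_minus_distrib_mat[OF carrier(1,4) one_carrier_mat]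
    using right_mult_one_mat[OF carrier(1)] by simp
  have "mat_adjoint M * M = mat_adjoint (G * (A' * A) - 1\<^sub>m (dim_col A)) * (A' * M)"
    by (subst M_eq) (simp add: mat_adjoint_mult assoc_mult_mat_dim A'_def M_def)
  then have "mat_adjoint M * M = 0\<^sub>m (dim_col M) (dim_col M)"
    unfolding A'_M by (auto simp: M_def)
  then have M_0: "M = 0\<^sub>m (dim_row A) (dim_col A)"
    using mat_adjoint_mult_self_eq_0[of M] by (simp add: M_def)
  have "(P * A) $$ (i, j) = A $$ (i, j)" if "i < dim_row A" "j < dim_col A" for i j
  proof -
    have "(P * A) $$ (i, j) - A $$ (i, j) = M $$ (i, j)"
      unfolding M_def using that by (intro index_minus_mat(1)[symmetric])
    then show ?thesis
      using that by (simp only: M_0 index_zero_mat right_minus_eq)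
  qed
  then have P_A: "P * A = A"
    by (intro eq_matI) auto
  \<comment> \<open>\<open>G\<close> need not be self-adjoint. But the adjoint of \<open>P\<close>
    also starts with the factor \<open>A\<close>, which \<open>P\<close> fixes; hence it equals
    \<open>P * mat_adjoint P\<close>, which is self-adjoint.\<close>
  have P_adjoint: "mat_adjoint P = A * (mat_adjoint G * A')"
    by (simp add: P_def mat_adjoint_mult assoc_mult_mat_dim A'_def)
  then have P_P': "P * mat_adjoint P = mat_adjoint P"
    using assoc_mult_mat_dim[of P A "mat_adjoint G * A'"] P_A by simp
  then have "mat_adjoint P = P"
    using arg_cong[OF P_P', of mat_adjoint] mat_adjoint_mult[of P "mat_adjoint P"] by simp
  moreover have "A * (G * A') = P"
    by (simp add: P_def assoc_mult_mat_dim)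
  moreover have "G * A' \<in> carrier_mat (dim_col A) (dim_row A)"
    by (intro carrier_matI) simp_all
  ultimately show ?thesis
    using P_A that[of "G * A'"] by simp
qed

text \<open>Take \<open>X\<close> with \<open>A * X\<close> self-adjoint and \<open>Y\<close> with
  \<open>Y * A\<close> self-adjoint, both generalized inverses of \<open>A\<close>. For
  \<open>B = Y * A * X\<close> one gets \<open>A * B = A * X\<close> and
  \<open>B * A = Y * A\<close>, which yields all four Penrose equations.\<close>

lemma is_pinv_exists:
  fixes A :: "complex mat"
  obtains B where "is_pinv A B"
proof -
  obtain X where "X \<in> carrier_mat (dim_col A) (dim_row A)"
    and X: "A * X * A = A" "mat_adjoint (A * X) = A * X"
    by (rule least_squares_inverse_exists)
  then have [simp]: "dim_row X = dim_col A" "dim_col X = dim_row A" by auto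
  \<comment> \<open>The one-sided result for the adjoint of \<open>A\<close> gives, after taking
    adjoints, the self-adjointness on the other side.\<close>
  obtain Y' where "Y' \<in> carrier_mat (dim_row A) (dim_col A)"
    and Y': "mat_adjoint A * Y' * mat_adjoint A = mat_adjoint A"
      "mat_adjoint (mat_adjoint A * Y') = mat_adjoint A * Y'"
    using least_squares_inverse_exists[of "mat_adjoint A"] by auto
  then have [simp]: "dim_row Y' = dim_row A" "dim_col Y' = dim_col A" by auto
  define Y where "Y = mat_adjoint Y'"
  have [simp]: "dim_row Y = dim_col A" "dim_col Y = dim_row A" by (auto simp: Y_def)
  have Y: "A * Y * A = A" "mat_adjoint (Y * A) = Y * A"
    using arg_cong[OF Y'(1), of mat_adjoint] Y'(2)
    by (auto simp: Y_def mat_adjoint_mult assoc_mult_mat_dim)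
  define B where "B = Y * A * X"
  have dim_B: "B \<in> carrier_mat (dim_col A) (dim_row A)"
    by (auto simp: B_def)
  have A_B: "A * B = A * X"
    using assoc_mult_mat_dim[of A "Y * A" X] assoc_mult_mat_dim[of A Y A] Y(1)
    by (simp add: B_def)
  have "B * A = Y * (A * X * A)"
    by (simp add: B_def assoc_mult_mat_dim)
  then have B_A: "B * A = Y * A"
    by (simp add: X(1))
  have "B * A * B = Y * (A * B)"
    using dim_B by (auto simp: B_A assoc_mult_mat_dim)
  also have "\<dots> = B"
    by (simp add: A_B) (simp add: B_def assoc_mult_mat_dim)
  finally show ?thesis
    using X(1,2) Y(2) dim_B by (intro that[of B]) (auto simp: is_pinv_def A_B B_A)
qed

text \<open>\<open>A * B\<close> and \<open>A * C\<close> are self-adjoint projections with the same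
  range, hence equal; likewise \<open>B * A\<close> and \<open>C * A\<close>. Then
  \<open>B = B * A * B\<close> can be rewritten into \<open>C * A * C = C\<close>.\<close>

lemma is_pinv_unique:
  fixes A :: "complex mat"
  assumes B: "is_pinv A B" and C: "is_pinv A C"
  shows "B = C"
proof -
  have [simp]: "dim_row B = dim_col A" "dim_col B = dim_row A"
    "dim_row C = dim_col A" "dim_col C = dim_row A"
    using assms by (auto simp: is_pinv_def)
  note eqs = B[unfolded is_pinv_def] C[unfolded is_pinv_def]
  have "A * B = mat_adjoint (A * C * A * B)"
    using eqs by metis
  also have "\<dots> = mat_adjoint (A * C * (A * B))"
    by (simp add: assoc_mult_mat_dim)
  also have "\<dots> = A * B * (A * C)"
    using eqs by (subst mat_adjoint_mult) auto
  also have "\<dots> = A * B * A * C"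
    by (simp add: assoc_mult_mat_dim)
  also have "\<dots> = A * C"
    using eqs by metis
  finally have AB: "A * B = A * C" .
  have "B * A = mat_adjoint (B * (A * C * A))"
    using eqs by metis
  also have "\<dots> = mat_adjoint (B * A * (C * A))"
    by (simp add: assoc_mult_mat_dim)
  also have "\<dots> = C * A * (B * A)"
    using eqs by (subst mat_adjoint_mult) auto
  also have "\<dots> = C * (A * B * A)"
    by (simp add: assoc_mult_mat_dim)
  also have "\<dots> = C * A"
    using eqs by metis
  finally have BA: "B * A = C * A" .
  have "B = B * A * B" using eqs by metis
  also have "\<dots> = C * (A * B)" by (simp add: BA assoc_mult_mat_dim)
  also have "\<dots> = C * A * C" by (simp add: AB assoc_mult_mat_dim)
  also have "\<dots> = C" using eqs by metis
  finally show ?thesis .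
qed

lemma is_pinv_pinv: "is_pinv A (pinv A)"
  unfolding pinv_def by (metis is_pinv_exists is_pinv_unique theI)

lemma pinv_carrier: "pinv A \<in> carrier_mat (dim_col A) (dim_row A)"
  using is_pinv_pinv unfolding is_pinv_def by blast

section \<open>The range of the pseudo-inverse and the kernel of the matrix\<close>

lemma mat_adjoint_sprod:
  fixes M :: "complex mat"
  assumes "x \<in> carrier_vec (dim_row M)" "y \<in> carrier_vec (dim_col M)"
  shows "(mat_adjoint M *\<^sub>v x) \<bullet>c y = x \<bullet>c (M *\<^sub>v y)"
proof -
  have "(mat_adjoint M *\<^sub>v x) \<bullet>c y =
    (\<Sum>j<dim_col M. \<Sum>i<dim_row M. cnj (M $$ (i, j)) * x $ i * cnj (y $ j))"
    using assms by (auto simp: scalar_prod_def lessThan_atLeast0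
        sum_distrib_right)
  also have "\<dots> = (\<Sum>i<dim_row M. \<Sum>j<dim_col M. cnj (M $$ (i, j)) * x $ i * cnj (y $ j))"
    by (rule sum.swap)
  also have "\<dots> = x \<bullet>c (M *\<^sub>v y)"
    using assms by (auto simp: scalar_prod_def lessThan_atLeast0
        sum_distrib_left mult_ac)
  finally show ?thesis .
qed

text \<open>The vector \<open>B *\<^sub>v w\<close> is fixed by \<open>B * A\<close>. This matrix is
  self-adjoint, so it can be moved to \<open>v\<close>, which it annihilates.\<close>

lemma pinv_image_orthogonal_kernel:
  assumes w: "w \<in> carrier_vec (dim_row A)" and v: "v \<in> carrier_vec (dim_col A)"
    and ker: "A *\<^sub>v v = 0\<^sub>v (dim_row A)"
  shows "(pinv A *\<^sub>v w) \<bullet>c v = 0"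
proof -
  define B where "B = pinv A"
  have B: "B \<in> carrier_mat (dim_col A) (dim_row A)" "B * A * B = B" "mat_adjoint (B * A) = B * A"
    using is_pinv_pinv[of A] by (auto simp: is_pinv_def B_def)
  have A: "A \<in> carrier_mat (dim_row A) (dim_col A)" by auto
  have B_w: "B *\<^sub>v w \<in> carrier_vec (dim_col A)"
    using B(1) w by (rule mult_mat_vec_carrier)
  have "B *\<^sub>v w = (B * A * B) *\<^sub>v w"
    by (simp only: B(2))
  also have "\<dots> = mat_adjoint (B * A) *\<^sub>v (B *\<^sub>v w)"
    unfolding B(3) by (rule assoc_mult_mat_vec[OF mult_carrier_mat[OF B(1) A] B(1) w])
  finally have "(B *\<^sub>v w) \<bullet>c v = (mat_adjoint (B * A) *\<^sub>v (B *\<^sub>v w)) \<bullet>c v"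
    by (rule arg_cong)
  also have "\<dots> = (B *\<^sub>v w) \<bullet>c ((B * A) *\<^sub>v v)"
    using B(1) B_w v by (intro mat_adjoint_sprod) simp_all
  also have "(B * A) *\<^sub>v v = 0\<^sub>v (dim_col A)"
    using assoc_mult_mat_vec[OF B(1) A v] ker B(1) by auto
  finally show ?thesis
    using B_w by (simp add: B_def)
qed

section \<open>Companion matrices\<close>

text \<open>The characteristic equation is read off an eigenvector without determinants: the rows of
  the eigenvector equation, weighted by powers of \<open>w\<close>, telescope to a multiple of the
  last entry, which is nonzero.\<close>

lemma companion_eigenvalue:
  fixes c :: "complex vec"
  assumes "eigenvalue (companion c) w"
  shows "w ^ dim_vec c = (\<Sum>i<dim_vec c. c $ i * w ^ i)"
proof -
  define n where "n = dim_vec c"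
  have T: "companion c = mat n n (\<lambda>(i, j). if j = n - 1 then c $ i else if i = j + 1 then 1 else 0)"
    by (simp add: companion_def n_def Let_def)
  obtain v where v: "v \<in> carrier_vec n" "v \<noteq> 0\<^sub>v n" "companion c *\<^sub>v v = w \<cdot>\<^sub>v v"
    using assms by (auto simp: eigenvalue_def eigenvector_def T)
  have "n \<noteq> 0"
    using v(1,2) by (auto intro: eq_vecI)
  then obtain k where n: "n = Suc k" by (cases n) auto
  have row: "(if i = 0 then 0 else v $ (i - 1)) + c $ i * v $ k = w * v $ i" if "i < n" for i
  proof -
    have "w * v $ i = (companion c *\<^sub>v v) $ i"
      using v that by simp
    also have "\<dots> = (\<Sum>j<n. (if j = k then c $ i else if i = j + 1 then 1 else 0) * v $ j)"
      using v(1) that by (simp add: T scalar_prod_def lessThan_atLeast0 n)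
    also have "\<dots> = c $ i * v $ k + (\<Sum>j<k. if i = j + 1 then v $ j else 0)"
      by (simp add: n if_distrib[of "\<lambda>x. x * _"] cong: if_cong)
    also have "(\<Sum>j<k. if i = j + 1 then v $ j else 0) = (if i = 0 then 0 else v $ (i - 1))"
      using that by (cases i) (auto simp: n)
    finally show ?thesis by simp
  qed
  \<comment> \<open>If the last entry were zero, \<open>row\<close> would carry the zero from each
    entry to the one before it, and \<open>v\<close> would vanish.\<close>
  have v_k: "v $ k \<noteq> 0"
  proof
    assume "v $ k = 0"
    then have "v $ (k - j) = 0" if "j \<le> k" for j
      using that
    proof (induction j)
      case (Suc j)
      then show ?case
        using row[of "k - j"] by (auto simp: n)
    qed auto
    from this[of "k - _"] have "v $ i = 0" if "i < n" for i
      using that by (metis diff_diff_cancel diff_le_self less_Suc_eq_le n)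
    then show False
      using v(1,2) by (auto intro: eq_vecI)
  qed
  \<comment> \<open>With weight \<open>w ^ i\<close> on row \<open>i\<close>, the sub-diagonal part
    cancels every term of the right-hand side except the one with \<open>i = k\<close>.\<close>
  have "(\<Sum>i<n. w ^ i * (if i = 0 then 0 else v $ (i - 1))) = (\<Sum>i<k. w ^ Suc i * v $ i)"
    unfolding n sum.lessThan_Suc_shift by simp
  then have "(\<Sum>i<k. w ^ Suc i * v $ i) + (\<Sum>i<n. c $ i * w ^ i) * v $ k
    = (\<Sum>i<n. w ^ i * ((if i = 0 then 0 else v $ (i - 1)) + c $ i * v $ k))"
    by (simp add: distrib_left sum.distrib sum_distrib_left mult_ac)
  also have "\<dots> = (\<Sum>i<n. w ^ Suc i * v $ i)"
    using row by (intro sum.cong) (auto simp: mult_ac)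
  finally have "(\<Sum>i<n. c $ i * w ^ i) * v $ k = w ^ n * v $ k"
    by (simp add: n)
  with v_k show ?thesis
    by (simp add: n_def)
qed

lemma geometric_sum_root_of_unity:
  fixes w :: complex
  assumes "w \<noteq> 1" "w ^ (n + 1) = 1"
  shows "w ^ n = - (\<Sum>i<n. w ^ i)"
  using assms geometric_sum[of w "n + 1"] by (simp add: eq_neg_iff_add_eq_0 add.commute)

text \<open>Each nontrivial root of unity \<open>w\<close> satisfies the characteristic equation and
  the geometric sum identity for \<open>w ^ n\<close>. Their difference is a polynomial
  \<open>p\<close> with coefficients \<open>c $ j + 1\<close>, of degree below n but with n roots,
  hence zero.\<close>

lemma companion_roots_of_unity:
  fixes c :: "complex vec"
  assumes "{w. w \<noteq> 1 \<and> w ^ (dim_vec c + 1) = 1} \<subseteq> spectrum (companion c)" "i < dim_vec c"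
  shows "c $ i = - 1"
proof -
  define n where "n = dim_vec c"
  define W :: "complex set" where "W = {w. w \<noteq> 1 \<and> w ^ (n + 1) = 1}"
  define p where "p = (\<Sum>j<n. monom (c $ j + 1) j)"
  have coeff_p: "coeff p j = (if j < n then c $ j + 1 else 0)" for j
    by (simp add: p_def coeff_sum)
  have "W = {w. w ^ (n + 1) = 1} - {1}" by (auto simp: W_def)
  then have card_W: "card W = n"
    using card_roots_unity_eq[of "n + 1"] by (simp add: card_Diff_subset)
  have "poly p w = 0" if "w \<in> W" for w
  proof -
    have "w ^ n = (\<Sum>j<n. c $ j * w ^ j)"
      using that assms(1) companion_eigenvalue[of c w] by (auto simp: W_def n_def spectrum_def)
    moreover have "w ^ n = - (\<Sum>j<n. w ^ j)"
      using that geometric_sum_root_of_unity by (simp add: W_def)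
    ultimately have "(\<Sum>j<n. c $ j * w ^ j) + (\<Sum>j<n. w ^ j) = 0"
      by (metis ab_group_add_class.ab_left_minus)
    then show ?thesis
      by (simp add: p_def poly_sum poly_monom distrib_right sum.distrib)
  qed
  then have sub: "W \<subseteq> {w. poly p w = 0}" by auto
  have "p = 0"
  proof (rule ccontr)
    assume "p \<noteq> 0"
    then have "n \<le> degree p"
      using card_mono[OF poly_roots_finite sub] card_poly_roots_bound[of p] card_W by simp
    then have "lead_coeff p = 0"
      by (simp add: coeff_p)
    with \<open>p \<noteq> 0\<close> show False by simp
  qed
  then show ?thesis
    using assms(2) coeff_p[of i] by (simp add: n_def eq_neg_iff_add_eq_0)
qed

section \<open>A kernel vector of the mean-subtracted data\<close>

text \<open>Newton interpolation, one node at a time. The bound is put on coefficients rather than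
  on the degree so that it also makes sense for empty \<open>S\<close>, where it forces
  \<open>p = 0\<close>.\<close>

lemma interpolation_poly_exists:
  fixes f :: "'a :: field \<Rightarrow> 'a"
  assumes "finite S"
  obtains p where "\<And>x. x \<in> S \<Longrightarrow> poly p x = f x" "\<And>j. j \<ge> card S \<Longrightarrow> coeff p j = 0"
proof -
  have "\<exists>p. (\<forall>x\<in>S. poly p x = f x) \<and> (\<forall>j\<ge>card S. coeff p j = 0)"
    using assms
  proof (induction S)
    case empty
    show ?case by (intro exI[of _ 0]) auto
  next
    case (insert a S)
    then obtain p where p: "\<forall>x\<in>S. poly p x = f x" "\<forall>j\<ge>card S. coeff p j = 0" by auto
    define q where "q = (\<Prod>s\<in>S. [:- s, 1:])"
    have q: "poly q x = (\<Prod>s\<in>S. x - s)" for x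
      by (simp add: q_def poly_prod)
    have deg: "degree q \<le> card S"
      using degree_prod_sum_le[OF insert(1), of "\<lambda>s. [:- s, 1:]"] by (simp add: q_def)
    have "poly q a \<noteq> 0" "\<And>x. x \<in> S \<Longrightarrow> poly q x = 0"
      using insert(1,2) by (auto simp: q)
    then show ?case
      using p deg insert(1,2)
      \<comment> \<open>The added multiple of \<open>q\<close> vanishes at the old nodes and
        corrects the value at \<open>a\<close>.\<close>
      by (intro exI[of _ "p + Polynomial.smult ((f a - poly p a) / poly q a) q"])
        (auto simp: coeff_eq_0)
  qed
  then show ?thesis using that by blast
qed

section \<open>Time averages of observables along an orbit\<close>

lemma koopman_eigenfunction_iterate:
  assumes "koopman_eigenfunction H \<Gamma> \<phi> l"
  shows "\<phi> ((\<Gamma> ^^ j) x) = l ^ j * \<phi> x"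
proof (induction j)
  case (Suc j)
  have "\<phi> (\<Gamma> y) = l * \<phi> y" for y
    using assms by (auto simp: koopman_eigenfunction_def koopman_def fun_eq_iff)
  with Suc show ?case by simp
qed auto

text \<open>On an eigenfunction with eigenvalue \<open>w\<close>, weights \<open>a\<close> act as
  multiplication by the polynomial value at \<open>w\<close>, and the time average as multiplication
  by \<open>avg w\<close>. Matching the two at all eigenvalues suffices, since both sides are linear
  in \<open>g\<close>.\<close>

lemma temporal_mean_filter_exists:
  assumes eig: "\<And>i. i \<in> I \<Longrightarrow> koopman_eigenfunction H \<Gamma> (\<phi> i) (lam i)"
    and "finite I" "card I < n"
  obtains a :: "nat \<Rightarrow> complex" where "(\<Sum>j<n. a j) = 1"
    "\<And>g. g \<in> cfun.span (\<phi> ` I) \<Longrightarrow>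
       (\<Sum>j<n. a j * g ((\<Gamma> ^^ j) x)) = (\<Sum>j\<le>n. g ((\<Gamma> ^^ j) x)) / of_nat (n + 1)"
proof -
  define avg where "avg = (\<lambda>w::complex. (\<Sum>j\<le>n. w ^ j) / of_nat (n + 1))"
  \<comment> \<open>The node 1 normalizes the weights: \<open>poly p 1\<close> is the sum of the
    coefficients, and \<open>avg 1 = 1\<close>.\<close>
  define S where "S = insert 1 (lam ` I)"
  have "finite S" and card_S: "card S \<le> n"
    using assms(2,3) card_image_le[of I lam] card_insert_le_m1[of n "lam ` I" 1]
    by (auto simp: S_def)
  obtain p where p: "\<And>w. w \<in> S \<Longrightarrow> poly p w = avg w" "\<And>j. j \<ge> card S \<Longrightarrow> coeff p j = 0"
    using interpolation_poly_exists[OF \<open>finite S\<close>] by metis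
  have poly_p: "poly p w = (\<Sum>j<n. coeff p j * w ^ j)" for w
  proof -
    have "poly p w = (\<Sum>j\<le>degree p. coeff p j * w ^ j)"
      by (rule poly_altdef)
    also have "\<dots> = (\<Sum>j\<in>{..<n} \<union> {..degree p}. coeff p j * w ^ j)"
      by (intro sum.mono_neutral_left) (auto simp: coeff_eq_0)
    also have "\<dots> = (\<Sum>j<n. coeff p j * w ^ j)"
      using p(2) card_S by (intro sum.mono_neutral_right) auto
    finally show ?thesis .
  qed
  show ?thesis
  proof (rule that[of "coeff p"])
    have "of_nat n + (1::complex) \<noteq> 0"
      using of_nat_neq_0[of n] by (simp add: add.commute)
    then show "(\<Sum>j<n. coeff p j) = 1"
      using poly_p[of 1] p(1)[of 1] by (simp add: S_def avg_def add.commute)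
  next
    fix g assume "g \<in> cfun.span (\<phi> ` I)"
    then show "(\<Sum>j<n. coeff p j * g ((\<Gamma> ^^ j) x)) = (\<Sum>j\<le>n. g ((\<Gamma> ^^ j) x)) / of_nat (n + 1)"
    proof (induction rule: cfun.span_induct_alt)
      case base
      show ?case by simp
    next
      case (step c f h)
      then obtain i where i: "i \<in> I" "f = \<phi> i" by auto
      have "(\<Sum>j<n. coeff p j * f ((\<Gamma> ^^ j) x)) = poly p (lam i) * f x"
        using koopman_eigenfunction_iterate[OF eig[OF i(1)]]
        by (simp add: i(2) poly_p sum_distrib_left mult_ac)
      also have "\<dots> = (\<Sum>j\<le>n. f ((\<Gamma> ^^ j) x)) / of_nat (n + 1)"
        using koopman_eigenfunction_iterate[OF eig[OF i(1)]] i p(1)[of "lam i"]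
        by (simp add: S_def avg_def sum_distrib_right)
      finally have f: "(\<Sum>j<n. coeff p j * f ((\<Gamma> ^^ j) x)) =
        (\<Sum>j\<le>n. f ((\<Gamma> ^^ j) x)) / of_nat (n + 1)" .
      have "(\<Sum>j<n. coeff p j * (c * f ((\<Gamma> ^^ j) x) + h ((\<Gamma> ^^ j) x))) =
        c * (\<Sum>j<n. coeff p j * f ((\<Gamma> ^^ j) x)) + (\<Sum>j<n. coeff p j * h ((\<Gamma> ^^ j) x))"
        by (simp add: distrib_left sum.distrib sum_distrib_left mult_ac)
      also have "\<dots> = (\<Sum>j\<le>n. c * f ((\<Gamma> ^^ j) x) + h ((\<Gamma> ^^ j) x)) / of_nat (n + 1)"
        unfolding f step by (simp add: sum.distrib sum_distrib_left add_divide_distrib)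
      finally show ?case by simp
    qed
  qed
qed

section \<open>The kernel vector and the contradiction\<close>

theorem theorem1p1:
  fixes \<Gamma> :: "real ^ 'p \<Rightarrow> real ^ 'p"
    and H :: "(real ^ 'p \<Rightarrow> complex) set"
    and \<phi> :: "nat \<Rightarrow> real ^ 'p \<Rightarrow> complex"
    and lam :: "nat \<Rightarrow> complex"
    and \<psi> :: "nat \<Rightarrow> real ^ 'p \<Rightarrow> complex"
    and \<upsilon>\<^sub>1 :: "real ^ 'p"
    and r m n :: nat
    and z :: "nat \<Rightarrow> complex vec"
  defines "z \<equiv> snapshot \<Gamma> m \<psi> \<upsilon>\<^sub>1"
  assumes H_subspace: "cfun.subspace H"
    and H_closed: "\<And>f. f \<in> H \<Longrightarrow> koopman \<Gamma> f \<in> H"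
    and eigenfunctions: "\<And>i. i \<in> {1..r} \<Longrightarrow> koopman_eigenfunction H \<Gamma> (\<phi> i) (lam i)"
    and distinct_eigenvalues: "inj_on lam {1..r}"
    and dictionary: "\<And>i. i \<in> {1..m} \<Longrightarrow> \<psi> i \<in> cfun.span (\<phi> ` {1..r})"
    and initial_state: "\<And>i. i \<in> {1..r} \<Longrightarrow> \<phi> i \<upsilon>\<^sub>1 \<noteq> 0"
    and consistent: "linearly_consistent (data_X m n z) (data_Y m n z)"
    and n_ge: "n \<ge> r + 1"
  shows "ms_DMD_eigenvalues m n z \<noteq> {w. w \<noteq> 1 \<and> w ^ (n + 1) = 1}"
proof
  assume dft: "ms_DMD_eigenvalues m n z = {w. w \<noteq> 1 \<and> w ^ (n + 1) = 1}"
  define A where "A = data_X_ms m n z"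
  define \<mu> where "\<mu> = temporal_mean m n z"
  define c where "c = ms_coeffs m n z"
  have dim_A: "dim_row A = m" "dim_col A = n"
    by (auto simp: A_def data_X_ms_def)
  have c: "c = pinv A *\<^sub>v (z (n + 1) - \<mu>)"
    by (simp add: c_def ms_coeffs_def A_def \<mu>_def)
  have dim_c: "dim_vec c = n"
    using pinv_carrier[of A] by (simp add: c dim_A)
  have "{w. w \<noteq> 1 \<and> w ^ (dim_vec c + 1) = 1} = spectrum (companion c)"
    using dft[symmetric] unfolding dim_c by (simp only: ms_DMD_eigenvalues_def c_def)
  then have c_eq: "c $ i = - 1" if "i < n" for i
    using that by (intro companion_roots_of_unity) (simp_all only: dim_c order_refl)
  have card: "card {1..r} < n"
    using n_ge by simp
  obtain a where a: "(\<Sum>j<n. a j) = 1" "\<And>g. g \<in> cfun.span (\<phi> ` {1..r}) \<Longrightarrow>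
      (\<Sum>j<n. a j * g ((\<Gamma> ^^ j) \<upsilon>\<^sub>1)) = (\<Sum>j\<le>n. g ((\<Gamma> ^^ j) \<upsilon>\<^sub>1)) / of_nat (n + 1)"
    using temporal_mean_filter_exists[where \<phi> = \<phi> and x = \<upsilon>\<^sub>1,
        OF eigenfunctions finite_atLeastAtMost card] by blast
  have z_index: "z j $ k = \<psi> (k + 1) ((\<Gamma> ^^ (j - 1)) \<upsilon>\<^sub>1)" if "k < m" for j k
    using that by (simp add: z_def snapshot_def)
  \<comment> \<open>Snapshot \<open>j\<close> uses the iterate \<open>j - 1\<close>, so the
    snapshots 1 to n + 1 become the iterates 0 to n.\<close>
  have \<mu>_index: "\<mu> $ k = (\<Sum>j\<le>n. \<psi> (k + 1) ((\<Gamma> ^^ j) \<upsilon>\<^sub>1)) / of_nat (n + 1)" if "k < m" for k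
  proof -
    have "(\<Sum>j = 1..n + 1. z j $ k) = (\<Sum>j\<le>n. z (Suc j) $ k)"
      using sum.shift_bounds_cl_Suc_ivl[of "\<lambda>j. z j $ k" 0 n] by (simp add: atMost_atLeast0)
    then show ?thesis
      using that by (simp add: \<mu>_def temporal_mean_def z_index)
  qed
  have dim_\<mu>: "dim_vec \<mu> = m"
    by (simp add: \<mu>_def temporal_mean_def)
  have A_index: "A $$ (k, j) = \<psi> (k + 1) ((\<Gamma> ^^ j) \<upsilon>\<^sub>1) - \<mu> $ k" if "k < m" "j < n" for k j
  proof -
    have "A $$ (k, j) = (z (Suc j) - \<mu>) $ k"
      using that by (simp add: A_def data_X_ms_def mat_of_cols_index \<mu>_def del: upt_Suc)
    then show ?thesis
      using that by (simp add: z_index dim_\<mu>)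
  qed
  have "A *\<^sub>v vec n a = 0\<^sub>v m"
  proof (rule eq_vecI)
    fix k assume "k < dim_vec (0\<^sub>v m :: complex vec)"
    then have k: "k < m" by simp
    have "(A *\<^sub>v vec n a) $ k = (\<Sum>j<n. (\<psi> (k + 1) ((\<Gamma> ^^ j) \<upsilon>\<^sub>1) - \<mu> $ k) * a j)"
      using k by (simp add: scalar_prod_def lessThan_atLeast0 dim_A A_index)
    \<comment> \<open>Because the weights sum to 1, the mean is subtracted exactly once, from a
      weighted sum that equals it by the choice of \<open>a\<close>.\<close>
    also have "\<dots> = (\<Sum>j<n. a j * \<psi> (k + 1) ((\<Gamma> ^^ j) \<upsilon>\<^sub>1)) - \<mu> $ k * (\<Sum>j<n. a j)"
      by (simp add: algebra_simps sum_subtractf sum_distrib_left)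
    also have "\<dots> = 0"
      using a(2)[OF dictionary[of "k + 1"]] k by (simp add: a(1) \<mu>_index)
    finally show "(A *\<^sub>v vec n a) $ k = 0\<^sub>v m $ k"
      using k by simp
  qed (simp add: dim_A)
  moreover have "z (n + 1) - \<mu> \<in> carrier_vec m"
    using dim_\<mu> by (intro carrier_vecI) simp
  ultimately have "c \<bullet>c vec n a = 0"
    unfolding c by (intro pinv_image_orthogonal_kernel) (simp_all add: dim_A)
  \<comment> \<open>All entries of \<open>c\<close> are -1, so the inner product is -1, while
    orthogonality makes it 0.\<close>
  moreover have "c \<bullet>c vec n a = - cnj (\<Sum>j<n. a j)"
    by (simp add: scalar_prod_def c_eq lessThan_atLeast0 sum_negf)
  ultimately show False
    by (simp add: a(1))
qed

end
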